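(* Let $n\ge 1$. Let $\mathcal O_{\tilde d}$ be the topology on $\tilde{\mathcal B}_n$ induced by the metric $\tilde d$, and let $\mathcal O_\pi$ be the quotient topology on $\tilde{\mathcal B}_n$ induced by the natural projection $\pi:\mathcal B_n\to\tilde{\mathcal B}_n$, where $\mathcal B_n$ carries the metric topology of $d$. Then the topological spaces $(\tilde{\mathcal B}_n,\mathcal O_{\tilde d})$ and $(\tilde{\mathcal B}_n,\mathcal O_\pi)$ are homeomorphic to each other. In particular $(\tilde{\mathcal B}_n,\mathcal O_\pi)$ is a Hausdorff space.
   Context: A body in $\mathbb R^n$ is a compact subset of $\mathbb R^n$ that is the closure of an open subset of $\mathbb R^n$; $\mathcal B_n$ denotes the set of all bodies in $\mathbb R^n$. The integral affine transformation group $G_n=\mathrm{AGL}(n,\mathbb Z)$ is the set $\mathrm{GL}(n,\mathbb Z)\times\mathbb R^n$ with multiplication $(A_1,t_1)\cdot(A_2,t_2)=(A_1A_2,\,A_1t_2+t_1)$; it acts on $\mathbb R^n$ by $(A,t)x=Ax+t$ and hence on $\mathcal B_n$ by taking images. The moduli space of bodies is the orbit set $\tilde{\mathcal B}_n:=\mathcal B_n/G_n$, and $[P]\in\tilde{\mathcal B}_n$ denotes the orbit of $P\in\mathcal B_n$; $\pi(P)=[P]$. The metric $d$ on $\mathcal B_n$ is $d(A,B):=\mathrm{vol}_n(A\bigtriangleup B)$, where $A\bigtriangleup B=(A\setminus B)\cup(B\setminus A)$ and $\mathrm{vol}_n$ is $n$-dimensional Lebesgue measure. The function $\tilde d$ on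 $\tilde{\mathcal B}_n\times\tilde{\mathcal B}_n$ is $\tilde d(\alpha,\beta):=\inf\{d(P_1,P_2)\mid [P_1]=\alpha,\ [P_2]=\beta\}$; it is a metric on $\tilde{\mathcal B}_n$. *)

theory Defs
  imports "HOL-Analysis.Analysis" "HOL-Algebra.Group_Action"
begin

text \<open>The empty set, being the closure of the empty open set, is a body.\<close>

definition bodies :: "(real ^ 'n) set set" where
  "bodies = {P. compact P \<and> (\<exists>U. open U \<and> P = closure U)}"

text \<open>Only the linear part is integral (invertibility is over the integers, so this is GL(n,Z));
  translations are arbitrary real vectors.\<close>

definition AGL :: "((int ^ 'n ^ 'n) \<times> (real ^ 'n)) monoid" where
  "AGL = \<lparr>carrier = {A. invertible A} \<times> UNIV,
          monoid.mult = (\<lambda>(A1, t1) (A2, t2). (A1 ** A2, map_matrix real_of_int A1 *v t2 + t1)),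
          one = (mat 1, 0)\<rparr>"

definition aff :: "(int ^ 'n ^ 'n) \<times> (real ^ 'n) \<Rightarrow> real ^ 'n \<Rightarrow> real ^ 'n" where
  "aff = (\<lambda>(A, t) x. map_matrix real_of_int A *v x + t)"

text \<open>\<^const>\<open>group_action\<close> requires the action to be extensional, hence the restriction
  to \<^const>\<open>bodies\<close>.\<close>

definition body_action :: "(int ^ 'n ^ 'n) \<times> (real ^ 'n) \<Rightarrow> (real ^ 'n) set \<Rightarrow> (real ^ 'n) set" where
  "body_action g = (\<lambda>P\<in>bodies. aff g ` P)"

definition body_class :: "(real ^ 'n) set \<Rightarrow> (real ^ 'n) set set" where
  "body_class P = orbit AGL body_action P"

definition moduli :: "(real ^ 'n) set set set" where
  "moduli = orbits AGL bodies body_action"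

definition body_dist :: "(real ^ 'n) set \<Rightarrow> (real ^ 'n) set \<Rightarrow> real" where
  "body_dist A B = measure lebesgue (sym_diff A B)"

text \<open>The value \<open>0\<close> outside \<^const>\<open>moduli\<close> is irrelevant for the mathematics; it is fixed because
  \<^const>\<open>Metric_space\<close> demands nonnegativity on the whole type and \<open>Inf {}\<close> is an unspecified
  real number.\<close>

definition moduli_dist :: "(real ^ 'n) set set \<Rightarrow> (real ^ 'n) set set \<Rightarrow> real" where
  "moduli_dist \<alpha> \<beta> =
    (if \<alpha> \<in> moduli \<and> \<beta> \<in> moduli
     then Inf {body_dist P1 P2 | P1 P2.
                 P1 \<in> bodies \<and> P2 \<in> bodies \<and> body_class P1 = \<alpha> \<and> body_class P2 = \<beta>}
     else 0)"

definition quotient_topology :: "'a topology \<Rightarrow> ('a \<Rightarrow> 'b) \<Rightarrow> 'b topology" where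
  "quotient_topology X p =
    topology (\<lambda>U. U \<subseteq> p ` topspace X \<and> openin X {x \<in> topspace X. p x \<in> U})"

definition body_topology :: "(real ^ 'n) set topology" where
  "body_topology = Metric_space.mtopology bodies body_dist"

definition moduli_metric_topology :: "(real ^ 'n) set set topology" where
  "moduli_metric_topology = Metric_space.mtopology moduli moduli_dist"

definition moduli_quotient_topology :: "(real ^ 'n) set set topology" where
  "moduli_quotient_topology = quotient_topology body_topology body_class"

lemma openin_quotient_topology:
  "openin (quotient_topology X p) U \<longleftrightarrow>
     U \<subseteq> p ` topspace X \<and> openin X {x \<in> topspace X. p x \<in> U}"
proof -
  have "istopology (\<lambda>U. U \<subseteq> p ` topspace X \<and> openin X {x \<in> topspace X. p x \<in> U})"
    unfolding istopology_def
  proof (intro conjI allI impI; (elim conjE)?)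
    fix S T assume "openin X {x \<in> topspace X. p x \<in> S}" "openin X {x \<in> topspace X. p x \<in> T}"
    moreover have "{x \<in> topspace X. p x \<in> S \<inter> T} =
        {x \<in> topspace X. p x \<in> S} \<inter> {x \<in> topspace X. p x \<in> T}" by auto
    ultimately show "openin X {x \<in> topspace X. p x \<in> S \<inter> T}" by auto
  next
    fix K assume *: "\<forall>S\<in>K. S \<subseteq> p ` topspace X \<and> openin X {x \<in> topspace X. p x \<in> S}"
    have "{x \<in> topspace X. p x \<in> \<Union>K} = (\<Union>S\<in>K. {x \<in> topspace X. p x \<in> S})" by auto
    then show "openin X {x \<in> topspace X. p x \<in> \<Union>K}" using * by auto
    show "\<Union>K \<subseteq> p ` topspace X" using * by auto
  qed auto
  then show ?thesis
    unfolding quotient_topology_def by (simp add: topology_inverse')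
qed

lemma topspace_quotient_topology: "topspace (quotient_topology X p) = p ` topspace X"
proof
  show "topspace (quotient_topology X p) \<subseteq> p ` topspace X"
    using openin_quotient_topology[of X p] openin_topspace by blast
  have "{x \<in> topspace X. p x \<in> p ` topspace X} = topspace X" by auto
  then have "openin (quotient_topology X p) (p ` topspace X)"
    by (simp add: openin_quotient_topology)
  then show "p ` topspace X \<subseteq> topspace (quotient_topology X p)"
    by (rule openin_subset)
qed

lemma quotient_map_quotient_topology: "quotient_map X (quotient_topology X p) p"
  by (auto simp: quotient_map_def openin_quotient_topology topspace_quotient_topology)

lemma map_matrix_of_int_mult:
  "map_matrix real_of_int (A ** B) = map_matrix real_of_int A ** map_matrix real_of_int B"
  by (simp add: vec_eq_iff matrix_matrix_mult_def)

lemma map_matrix_of_int_mat1: "map_matrix real_of_int (mat 1) = mat 1"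
  by (simp add: vec_eq_iff mat_def)

lemma aff_mult: "aff (g \<otimes>\<^bsub>AGL\<^esub> h) x = aff g (aff h x)"
  by (cases g; cases h)
     (simp add: aff_def AGL_def map_matrix_of_int_mult matrix_vector_right_distrib
        matrix_vector_mul_assoc)

lemma aff_one: "aff \<one>\<^bsub>AGL\<^esub> x = x"
  by (simp add: aff_def AGL_def map_matrix_of_int_mat1)

lemma group_AGL: "group (AGL :: ((int ^ 'n ^ 'n) \<times> (real ^ 'n)) monoid)"
proof (rule groupI)
  fix g h k :: "(int ^ 'n ^ 'n) \<times> (real ^ 'n)"
  assume g: "g \<in> carrier AGL" and h: "h \<in> carrier AGL"
  show "g \<otimes>\<^bsub>AGL\<^esub> h \<in> carrier AGL"
    using g h by (cases g; cases h) (auto simp: AGL_def invertible_mult)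
  show "g \<otimes>\<^bsub>AGL\<^esub> h \<otimes>\<^bsub>AGL\<^esub> k = g \<otimes>\<^bsub>AGL\<^esub> (h \<otimes>\<^bsub>AGL\<^esub> k)"
    by (cases g; cases h; cases k)
       (simp add: AGL_def map_matrix_of_int_mult matrix_vector_right_distrib
          matrix_vector_mul_assoc matrix_mul_assoc)
  show "\<one>\<^bsub>AGL\<^esub> \<otimes>\<^bsub>AGL\<^esub> g = g"
    by (cases g) (simp add: AGL_def map_matrix_of_int_mat1)
  obtain A t where gA: "g = (A, t)" by (cases g)
  with g have "invertible A" by (auto simp: AGL_def)
  then obtain B where B: "A ** B = mat 1" "B ** A = mat 1" by (auto simp: invertible_def)
  show "\<exists>h\<in>carrier AGL. h \<otimes>\<^bsub>AGL\<^esub> g = \<one>\<^bsub>AGL\<^esub>"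
  proof
    show "(B, - (map_matrix real_of_int B *v t)) \<otimes>\<^bsub>AGL\<^esub> g = \<one>\<^bsub>AGL\<^esub>"
      by (simp add: AGL_def gA B)
    show "(B, - (map_matrix real_of_int B *v t)) \<in> carrier AGL"
      using B by (auto simp: AGL_def invertible_def)
  qed
next
  show "\<one>\<^bsub>AGL\<^esub> \<in> carrier (AGL :: ((int ^ 'n ^ 'n) \<times> (real ^ 'n)) monoid)"
    by (auto simp: AGL_def invertible_def intro!: exI[of _ "mat 1"])
qed

lemma continuous_on_aff: "continuous_on S (aff g)"
  by (cases g) (auto simp: aff_def intro!: continuous_intros matrix_vector_mult_linear_continuous_on)

lemma homeomorphism_aff:
  assumes "g \<in> carrier AGL"
  shows "homeomorphism UNIV UNIV (aff g) (aff (inv\<^bsub>AGL\<^esub> g))"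
proof -
  interpret group AGL by (rule group_AGL)
  have 1: "aff (inv\<^bsub>AGL\<^esub> g) (aff g x) = x" for x
    using assms by (simp flip: aff_mult add: aff_one)
  have 2: "aff g (aff (inv\<^bsub>AGL\<^esub> g) x) = x" for x
    using assms by (simp flip: aff_mult add: aff_one)
  show ?thesis
    by (rule homeomorphismI) (auto simp: continuous_on_aff 1 2)
qed

lemma aff_image_bodies:
  assumes "g \<in> carrier AGL" "P \<in> bodies"
  shows "aff g ` P \<in> bodies"
proof -
  obtain U where U: "open U" "P = closure U" and "compact P"
    using assms(2) by (auto simp: bodies_def)
  note hom = homeomorphism_aff[OF assms(1)]
  have "compact (aff g ` P)"
    using \<open>compact P\<close> continuous_on_aff compact_continuous_image by blast
  moreover have "open (aff g ` U)"
    using homeomorphism_imp_open_map[OF hom, of U] U(1) by simp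
  moreover have "aff g ` P = closure (aff g ` U)"
  proof
    show "aff g ` P \<subseteq> closure (aff g ` U)"
      unfolding U(2)
      by (rule image_closure_subset) (auto simp: continuous_on_aff closure_subset)
    show "closure (aff g ` U) \<subseteq> aff g ` P"
      using \<open>compact (aff g ` P)\<close> U(2) closure_subset[of U]
      by (intro closure_minimal image_mono compact_imp_closed) auto
  qed
  ultimately show ?thesis by (auto simp: bodies_def)
qed

lemma group_action_bodies: "group_action AGL bodies body_action"
proof -
  interpret group AGL by (rule group_AGL)
  have inverse: "aff (inv\<^bsub>AGL\<^esub> g) ` aff g ` P = P" "aff g ` aff (inv\<^bsub>AGL\<^esub> g) ` P = P"
    if "g \<in> carrier AGL" for g P
    using that by (simp_all add: image_image aff_one flip: aff_mult)
  have Bij: "body_action g \<in> Bij bodies" if g: "g \<in> carrier AGL" for g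
    unfolding Bij_def
  proof (intro IntI CollectI)
    show "body_action g \<in> extensional bodies" by (simp add: body_action_def)
    show "bij_betw (body_action g) bodies bodies"
      by (rule bij_betw_byWitness[where f' = "body_action (inv\<^bsub>AGL\<^esub> g)"])
         (use g in \<open>auto simp: body_action_def aff_image_bodies inverse\<close>)
  qed
  have "body_action (g \<otimes>\<^bsub>AGL\<^esub> h) = body_action g \<otimes>\<^bsub>BijGroup bodies\<^esub> body_action h"
    if "g \<in> carrier AGL" "h \<in> carrier AGL" for g h
  proof -
    have "body_action (g \<otimes>\<^bsub>AGL\<^esub> h) = compose bodies (body_action g) (body_action h)"
      using that by (auto simp: fun_eq_iff compose_def body_action_def aff_image_bodies image_image aff_mult)
    then show ?thesis
      using Bij[OF that(1)] Bij[OF that(2)] by (simp add: BijGroup_def)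
  qed
  moreover have "body_action \<in> carrier AGL \<rightarrow> carrier (BijGroup bodies)"
    using Bij by (auto simp: BijGroup_def)
  ultimately have "body_action \<in> hom AGL (BijGroup bodies)"
    by (simp only: hom_def mem_Collect_eq) blast
  then show ?thesis
    by (simp add: group_action_def group_hom_def group_hom_axioms_def group_AGL group_BijGroup)
qed

end

theory Submission
  imports Defs
begin

text \<open>The group acts on bodies by isometries, so a ball around an orbit is the projection of a ball
  around a representative; this identifies the two topologies once \<open>moduli_dist\<close> is known to be a
  metric. The only difficult point is definiteness: if the images \<open>g\<^sub>k Q\<close> converge to \<open>P\<close>, then the
  linear parts of the \<open>g\<^sub>k\<close> are bounded, hence finite in number because they are integral, and the
  translations are bounded too, so a subsequence of the \<open>g\<^sub>k\<close> converges to some \<open>g\<close> with \<open>P = g Q\<close>.\<close>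

section \<open>Integral unimodular affine maps preserve Lebesgue measure\<close>

text \<open>The library computes the volume of linear images only for well-ordered index types, so matrices
  over an arbitrary finite index type are reindexed by this well-ordered copy.\<close>

typedef (overloaded) ('a::finite) rank = "{..<CARD('a)}"
  by (rule exI[of _ 0]) simp

instance rank :: (finite) finite
proof
  have "(UNIV :: 'a rank set) = Abs_rank ` {..<CARD('a)}"
    by (metis type_definition.Abs_image type_definition_rank)
  then show "finite (UNIV :: 'a rank set)"
    by (metis finite_imageI finite_lessThan)
qed

instantiation rank :: (finite) wellorder
begin

definition "a \<le> b \<longleftrightarrow> Rep_rank a \<le> Rep_rank b"
definition "a < b \<longleftrightarrow> Rep_rank a < Rep_rank b"

instance
proof
  fix P and a :: "'a rank"
  assume *: "\<And>x :: 'a rank. (\<And>y. y < x \<Longrightarrow> P y) \<Longrightarrow> P x"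
  show "P a"
    by (induction a rule: measure_induct_rule[of Rep_rank]) (auto intro: * simp: less_rank_def)
qed (auto simp: less_eq_rank_def less_rank_def Rep_rank_inject)

end

lemma ex_bij_rank: "\<exists>\<sigma> :: 'a::finite rank \<Rightarrow> 'a. bij \<sigma>"
proof -
  have "CARD('a rank) = CARD('a)"
    by (simp add: type_definition.card[OF type_definition_rank])
  then show ?thesis
    by (intro finite_same_card_bij) auto
qed

lemma det_map_matrix_of_int:
  "det (map_matrix real_of_int A) = of_int (det A)"
  by (simp add: det_def)

text \<open>The determinants of \<open>A\<close> and \<open>B\<close> are integers with product 1,
  and the only units of the integers are 1 and -1.\<close>

lemma abs_det_map_matrix_of_int:
  assumes "A ** B = mat 1"
  shows "\<bar>det (map_matrix real_of_int A)\<bar> = 1"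
proof -
  have "det A * det B = 1"
    using assms by (metis det_I det_mul)
  then have "\<bar>det A\<bar> = 1"
    by (auto simp: zmult_eq_1_iff)
  then show ?thesis
    by (simp add: det_map_matrix_of_int flip: of_int_abs)
qed

text \<open>Lebesgue measure is determined by its values on boxes. Since \<open>A\<close> and
  \<open>B\<close> are mutually inverse, the preimage of a box under \<open>A\<close> is its image
  under \<open>B\<close>, and its volume is scaled by the absolute determinant of \<open>B\<close>,
  which is 1.\<close>

lemma lborel_distr_unimodular_wellorder:
  fixes A B :: "int ^ 'n::{finite,wellorder} ^ 'n::_"
  assumes AB: "A ** B = mat 1" "B ** A = mat 1"
  shows "distr lborel borel ((*v) (map_matrix real_of_int A)) = lborel"
proof (rule lborel_eqI[symmetric])
  let ?A = "map_matrix real_of_int A" and ?B = "map_matrix real_of_int B"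
  fix l u :: "real ^ 'n::_"
  assume le: "\<And>b. b \<in> Basis \<Longrightarrow> l \<bullet> b \<le> u \<bullet> b"
  have inv: "?A *v (?B *v x) = x" "?B *v (?A *v x) = x" for x
    by (simp_all add: matrix_vector_mul_assoc AB map_matrix_of_int_mat1 flip: map_matrix_of_int_mult)
  have meas: "(*v) ?A \<in> borel_measurable borel"
    by (intro borel_measurable_continuous_onI matrix_vector_mult_linear_continuous_on)
  have pre: "(*v) ?A -` box l u = (*v) ?B ` box l u" (is "?P = _")
  proof (intro Set.set_eqI iffI)
    fix x assume "x \<in> ?P"
    then show "x \<in> (*v) ?B ` box l u"
      by (intro image_eqI[of _ _ "?A *v x"]) (simp_all only: inv vimage_eq)
  next
    fix x assume "x \<in> (*v) ?B ` box l u"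
    then show "x \<in> ?P"
      by (elim imageE) (simp only: inv vimage_eq)
  qed
  have "?P \<in> sets borel"
    using measurable_sets[OF meas, of "box l u"] by simp
  then have "emeasure lborel ?P = emeasure lebesgue ?P"
    by simp
  also have "\<dots> = measure lebesgue ?P"
    unfolding pre by (intro emeasure_eq_measure2 measurable_linear_image) auto
  also have "measure lebesgue ?P = measure lebesgue (box l u)"
    unfolding pre
    by (subst measure_linear_image) (auto simp: abs_det_map_matrix_of_int[OF AB(2)])
  also have "\<dots> = (\<Prod>b\<in>Basis. (u - l) \<bullet> b)"
    using le by (simp add: measure_lborel_box_eq inner_diff_left)
  finally show "emeasure (distr lborel borel ((*v) ?A)) (box l u) = (\<Prod>b\<in>Basis. (u - l) \<bullet> b)"
    using meas by (simp add: emeasure_distr)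
qed simp

text \<open>Again it suffices to test boxes: the preimage of a box is a box with the same side
  lengths in another order, so the product of the side lengths is unchanged.\<close>

lemma lborel_distr_reindex:
  fixes \<sigma> :: "'m::finite \<Rightarrow> 'n::finite"
  assumes sig: "\<And>i. \<tau> (\<sigma> i) = i" "\<And>j. \<sigma> (\<tau> j) = j"
  shows "distr lborel borel (\<lambda>x :: real ^ 'n. \<chi> i. x $ \<sigma> i) = lborel"
proof (rule lborel_eqI[symmetric])
  let ?T = "\<lambda>x :: real ^ 'n. \<chi> i. x $ \<sigma> i" and ?S = "\<lambda>x :: real ^ 'm. \<chi> j. x $ \<tau> j"
  fix l u :: "real ^ 'm"
  assume "\<And>b. b \<in> Basis \<Longrightarrow> l \<bullet> b \<le> u \<bullet> b"
  then have le: "l $ i \<le> u $ i" for i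
    by (simp add: axis_in_Basis_iff cart_eq_inner_axis)
  have "?T -` box l u = box (?S l) (?S u)"
  proof (rule Set.set_eqI)
    fix x
    have "(\<forall>i. l $ i < x $ \<sigma> i \<and> x $ \<sigma> i < u $ i) \<longleftrightarrow>
        (\<forall>j. l $ \<tau> j < x $ j \<and> x $ j < u $ \<tau> j)"
      by (metis sig)
    then show "x \<in> ?T -` box l u \<longleftrightarrow> x \<in> box (?S l) (?S u)"
      by (simp add: mem_box_cart)
  qed
  moreover have "?T \<in> borel_measurable borel"
    by (intro borel_measurable_continuous_onI continuous_intros)
  moreover have "emeasure lborel (box (?S l) (?S u)) = (\<Prod>b\<in>Basis. (?S u - ?S l) \<bullet> b)"
    by (intro emeasure_lborel_box) (auto simp: Basis_vec_def inner_axis le)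
  moreover have "(\<Prod>b\<in>Basis. (?S u - ?S l) \<bullet> b) = (\<Prod>b\<in>Basis. (u - l) \<bullet> b)"
  proof -
    \<comment> \<open>Stated for an arbitrary index type because it rewrites the products over both
      the old and the new coordinates.\<close>
    have Basis_prod: "(\<Prod>b\<in>Basis. v \<bullet> b) = (\<Prod>i\<in>UNIV. v $ i)" for v :: "real ^ 'k"
      unfolding Basis_vec_def
      by (subst prod.UNION_disjoint) (auto simp: inner_axis axis_eq_axis)
    have "bij \<tau>"
      using sig by (intro bij_betw_byWitness[where f' = \<sigma>]) auto
    then have "(\<Prod>j\<in>UNIV. (u - l) $ \<tau> j) = (\<Prod>i\<in>UNIV. (u - l) $ i)"
      by (rule prod.reindex_bij_betw)
    then show ?thesis
      by (simp add: Basis_prod)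
  qed
  ultimately show "emeasure (distr lborel borel ?T) (box l u) = (\<Prod>b\<in>Basis. (u - l) \<bullet> b)"
    by (simp add: emeasure_distr)
qed simp

text \<open>Multiplication by \<open>A\<close> factors as reindexing to \<open>rank\<close>,
  multiplication by the reindexed matrix, and reindexing back; each of the three factors preserves
  the measure.\<close>

lemma lborel_distr_unimodular:
  fixes A B :: "int ^ 'n ^ 'n"
  assumes AB: "A ** B = mat 1" "B ** A = mat 1"
  shows "distr lborel borel ((*v) (map_matrix real_of_int A)) = lborel"
proof -
  obtain \<sigma> :: "'n rank \<Rightarrow> 'n" where \<sigma>: "bij \<sigma>"
    using ex_bij_rank by blast
  define \<tau> where "\<tau> = inv_into UNIV \<sigma>"
  have sig: "\<tau> (\<sigma> i) = i" "\<sigma> (\<tau> j) = j" for i j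
    using \<sigma> by (simp_all add: \<tau>_def bij_is_inj bij_is_surj surj_f_inv_f)
  define re where "re M = (\<chi> i j. M $ \<sigma> i $ \<sigma> j)" for M :: "int ^ 'n ^ 'n"
  let ?A = "map_matrix real_of_int A" and ?A' = "map_matrix real_of_int (re A)"
  let ?T = "\<lambda>x :: real ^ 'n. \<chi> i. x $ \<sigma> i" and ?S = "\<lambda>x :: real ^ 'n rank. \<chi> j. x $ \<tau> j"
  \<comment> \<open>\<open>re\<close> permutes rows and columns by the same bijection, so it
    respects products and the identity and carries the inverse pair \<open>A\<close>,
    \<open>B\<close> to an inverse pair.\<close>
  have re_mult: "re (M ** N) = re M ** re N" for M N
    by (simp add: re_def vec_eq_iff matrix_matrix_mult_def sum.reindex_bij_betw[OF \<sigma>, of "\<lambda>k. M $ _ $ k * N $ k $ _"])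
  have "re (mat 1) = mat 1"
    using \<sigma> by (simp add: re_def mat_def vec_eq_iff bij_def inj_eq)
  then have "re A ** re B = mat 1" "re B ** re A = mat 1"
    by (simp_all add: AB flip: re_mult)
  then have A': "distr lborel borel ((*v) ?A') = lborel"
    by (rule lborel_distr_unimodular_wellorder)
  have eq: "(*v) ?A = ?S \<circ> ((*v) ?A' \<circ> ?T)"
  proof
    fix x
    have "(\<Sum>i\<in>UNIV. real_of_int (A $ k $ \<sigma> i) * x $ \<sigma> i) = (\<Sum>j\<in>UNIV. real_of_int (A $ k $ j) * x $ j)" for k
      by (rule sum.reindex_bij_betw[OF \<sigma>, of "\<lambda>j. real_of_int (A $ k $ j) * x $ j"])
    then show "?A *v x = (?S \<circ> ((*v) ?A' \<circ> ?T)) x"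
      by (simp add: vec_eq_iff matrix_vector_mult_def re_def sig)
  qed
  have meas: "?T \<in> borel_measurable borel" "?S \<in> borel_measurable borel" "(*v) ?A' \<in> borel_measurable borel"
    by (intro borel_measurable_continuous_onI continuous_intros matrix_vector_mult_linear_continuous_on)+
  have "distr lborel borel ((*v) ?A) = distr (distr (distr lborel borel ?T) borel ((*v) ?A')) borel ?S"
    unfolding eq using meas by (simp add: distr_distr)
  also have "\<dots> = lborel"
    using \<sigma> by (simp add: lborel_distr_reindex[OF sig] lborel_distr_reindex[OF sig(2,1)] A')
  finally show ?thesis .
qed

lemma lborel_distr_aff:
  assumes "g \<in> carrier AGL"
  shows "distr lborel borel (aff g) = lborel"
proof (cases g)
  case (Pair A t)
  obtain B where "A ** B = mat 1" "B ** A = mat 1"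
    using assms by (auto simp: Pair AGL_def invertible_def)
  then have A: "distr lborel borel ((*v) (map_matrix real_of_int A)) = lborel"
    by (rule lborel_distr_unimodular)
  have "aff g = (+) t \<circ> (*v) (map_matrix real_of_int A)"
    by (auto simp: aff_def Pair)
  moreover have "(*v) (map_matrix real_of_int A) \<in> borel_measurable borel"
    by (intro borel_measurable_continuous_onI matrix_vector_mult_linear_continuous_on)
  ultimately have "distr lborel borel (aff g) = distr (distr lborel borel ((*v) (map_matrix real_of_int A))) borel ((+) t)"
    by (simp add: distr_distr)
  then show ?thesis
    by (simp add: A lborel_distr_plus)
qed

text \<open>The image under \<open>g\<close> is the preimage under its group inverse, so invariance
  of the pushforward measure under that inverse gives the claim.\<close>

lemma measure_aff_image:
  assumes g: "g \<in> carrier AGL" and S: "S \<in> sets borel"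
  shows "measure lebesgue (aff g ` S) = measure lebesgue S"
proof -
  interpret group AGL by (rule group_AGL)
  let ?h = "inv\<^bsub>AGL\<^esub> g"
  have meas: "aff ?h \<in> borel_measurable borel"
    by (intro borel_measurable_continuous_onI continuous_on_aff)
  have eq: "aff g ` S = aff ?h -` S"
  proof -
    have "aff ?h (aff g x) = x" "aff g (aff ?h x) = x" for x
      using g by (simp_all flip: aff_mult add: aff_one)
    then show ?thesis
      by (intro Set.set_eqI) (metis image_iff vimage_eq)
  qed
  have "measure lborel S = measure (distr lborel borel (aff ?h)) S"
    using g by (simp add: lborel_distr_aff)
  also have "\<dots> = measure lborel (aff g ` S)"
    using S meas by (simp add: measure_distr eq)
  finally show ?thesis
    using S measurable_sets[OF meas S] by (simp add: eq)
qed

section \<open>The symmetric difference metric on bodies\<close>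

lemma bodies_lmeasurable: "P \<in> bodies \<Longrightarrow> P \<in> lmeasurable"
  by (simp add: bodies_def lmeasurable_compact)

lemma bodies_closed: "P \<in> bodies \<Longrightarrow> closed P"
  by (simp add: bodies_def compact_imp_closed)

text \<open>This is where being the closure of an open set matters: if the open set \<open>U\<close>
  leaves the closed set \<open>C\<close>, then \<open>U - C\<close> is open and nonempty and
  contains a ball. Failure of an inclusion is thereby witnessed by a set of positive volume.\<close>

lemma bodies_subsetI:
  assumes "P \<in> bodies" "closed C"
    and "\<And>x e. e > 0 \<Longrightarrow> ball x e \<subseteq> P \<Longrightarrow> ball x e \<inter> C = {} \<Longrightarrow> False"
  shows "P \<subseteq> C"
proof -
  obtain U where U: "open U" "P = closure U"
    using assms(1) by (auto simp: bodies_def)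
  have "U \<subseteq> C"
  proof
    fix x assume "x \<in> U"
    show "x \<in> C"
    proof (rule ccontr)
      assume "x \<notin> C"
      moreover have "open (U - C)"
        using U(1) assms(2) by (rule open_Diff)
      ultimately obtain e where "e > 0" "ball x e \<subseteq> U - C"
        using \<open>x \<in> U\<close> by (meson DiffI openE)
      then show False
        using assms(3)[of e x] U(2) closure_subset[of U] by blast
    qed
  qed
  then show ?thesis
    using U(2) assms(2) by (simp add: closure_minimal)
qed

lemma measure_ball_pos: "e > 0 \<Longrightarrow> measure lebesgue (ball (x :: real ^ 'n) e) > 0"
  using content_ball_pos[of e x] by simp

lemma measure_Diff_le_body_dist:
  assumes "P \<in> bodies" "Q \<in> bodies"
  shows "measure lebesgue (P - Q) \<le> body_dist P Q" "measure lebesgue (Q - P) \<le> body_dist P Q"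
  unfolding body_dist_def using assms
  by (auto intro!: measure_mono_fmeasurable simp: bodies_lmeasurable fmeasurable.Un fmeasurable.Diff fmeasurableD)

text \<open>A ball inside one body that misses the other would give their difference positive
  volume.\<close>

lemma body_dist_eq_0D:
  assumes P: "P \<in> bodies" and Q: "Q \<in> bodies" and 0: "body_dist P Q = 0"
  shows "P = Q"
proof -
  have "A \<subseteq> B" if "A \<in> bodies" "B \<in> bodies" "measure lebesgue (A - B) \<le> 0" for A B :: "(real ^ 'n) set"
  proof (rule bodies_subsetI)
    fix x e assume "e > 0" "ball x e \<subseteq> A" "ball x e \<inter> B = {}"
    then have "measure lebesgue (ball x e) \<le> measure lebesgue (A - B)"
      using that by (intro measure_mono_fmeasurable) (auto simp: bodies_lmeasurable fmeasurable.Diff fmeasurableD)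
    then show False
      using measure_ball_pos[OF \<open>e > 0\<close>, of x] that(3) by linarith
  qed (use that bodies_closed in auto)
  from this[of P Q] this[of Q P] show ?thesis
    using measure_Diff_le_body_dist[OF P Q] P Q 0 by auto
qed

lemma body_dist_commute: "body_dist P Q = body_dist Q P"
  by (simp add: body_dist_def Un_commute)

lemma body_dist_triangle:
  assumes "P \<in> bodies" "Q \<in> bodies" "R \<in> bodies"
  shows "body_dist P R \<le> body_dist P Q + body_dist Q R"
proof -
  have meas: "sym_diff A B \<in> lmeasurable" if "A \<in> bodies" "B \<in> bodies" for A B :: "(real ^ 'n) set"
    using that by (intro fmeasurable.Un fmeasurable.Diff bodies_lmeasurable)
  have "body_dist P R \<le> measure lebesgue (sym_diff P Q \<union> sym_diff Q R)"
    unfolding body_dist_def using assms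
    by (intro measure_mono_fmeasurable fmeasurable.Un[OF meas meas] fmeasurableD[OF meas]) auto
  also have "\<dots> \<le> body_dist P Q + body_dist Q R"
    unfolding body_dist_def using assms by (intro measure_Un_le fmeasurableD[OF meas])
  finally show ?thesis .
qed

lemma Metric_space_bodies: "Metric_space bodies body_dist"
proof
  show "body_dist P Q = 0 \<longleftrightarrow> P = Q" if "P \<in> bodies" "Q \<in> bodies" for P Q :: "(real ^ 'n) set"
    using that body_dist_eq_0D by (auto simp: body_dist_def)
qed (auto simp: body_dist_triangle body_dist_commute, simp add: body_dist_def)

section \<open>Invariance of the metric and the distance between orbits\<close>

lemma body_dist_aff_image:
  assumes "g \<in> carrier AGL" "P \<in> bodies" "Q \<in> bodies"
  shows "body_dist (aff g ` P) (aff g ` Q) = body_dist P Q"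
proof -
  have "inj (aff g)"
    using homeomorphism_aff[OF assms(1)] by (metis homeomorphism_def inj_on_inverseI)
  then have "sym_diff (aff g ` P) (aff g ` Q) = aff g ` sym_diff P Q"
    by (simp add: image_Un image_set_diff)
  moreover have "sym_diff P Q \<in> sets borel"
    using assms by (intro sets.Un sets.Diff) (simp_all add: bodies_closed)
  ultimately show ?thesis
    using assms(1) by (simp add: body_dist_def measure_aff_image)
qed

lemma body_class_eq: "P \<in> bodies \<Longrightarrow> body_class P = {aff g ` P | g. g \<in> carrier AGL}"
  by (simp add: body_class_def orbit_def body_action_def)

lemma body_class_eq_iff:
  assumes P: "P \<in> bodies" and Q: "Q \<in> bodies"
  shows "body_class P = body_class Q \<longleftrightarrow> (\<exists>g\<in>carrier AGL. P = aff g ` Q)"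
proof
  interpret group_action AGL bodies body_action by (rule group_action_bodies)
  assume "body_class P = body_class Q"
  then have "P \<in> body_class Q"
    using orbit_refl[OF P] by (simp add: body_class_def)
  then show "\<exists>g\<in>carrier AGL. P = aff g ` Q"
    using Q by (auto simp: body_class_eq)
next
  interpret group_action AGL bodies body_action by (rule group_action_bodies)
  assume "\<exists>g\<in>carrier AGL. P = aff g ` Q"
  then have PQ: "P \<in> body_class Q"
    using Q by (auto simp: body_class_eq)
  have sub: "R' \<in> bodies" if "R \<in> bodies" "R' \<in> body_class R" for R R' :: "(real ^ 'n) set"
    using that by (auto simp: body_class_eq aff_image_bodies)
  \<comment> \<open>Proved for arbitrary bodies so that it can be applied in both directions; orbit
    symmetry supplies the reversed membership.\<close>
  have "body_class P \<subseteq> body_class Q" if "P \<in> bodies" "Q \<in> bodies" "P \<in> body_class Q" for P Q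
    using orbit_trans[OF that(2,1)] sub that unfolding body_class_def by blast
  moreover have "Q \<in> body_class P"
    using orbit_sym[OF Q P] PQ by (simp add: body_class_def)
  ultimately show "body_class P = body_class Q"
    using PQ P Q by blast
qed

lemma moduli_eq: "moduli = body_class ` bodies"
  by (auto simp: moduli_def orbits_def body_class_def)

lemma bounded_bodies: "P \<in> bodies \<Longrightarrow> bounded P"
  by (simp add: bodies_def compact_imp_bounded)


text \<open>Applying the inverse of \<open>g\<close> to both bodies shows that the pair
  \<open>g P\<close>, \<open>h Q\<close> is as far apart as \<open>P\<close> and the image of
  \<open>Q\<close> under the product of that inverse with \<open>h\<close>. Hence one representative
  can be held fixed.\<close>

lemma moduli_dist_body_class:
  assumes P: "P \<in> bodies" and Q: "Q \<in> bodies"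
  shows "moduli_dist (body_class P) (body_class Q) = (INF g\<in>carrier AGL. body_dist P (aff g ` Q))"
proof -
  interpret group AGL by (rule group_AGL)
  have "{body_dist P1 P2 | P1 P2. P1 \<in> bodies \<and> P2 \<in> bodies \<and>
      body_class P1 = body_class P \<and> body_class P2 = body_class Q} =
    (\<lambda>g. body_dist P (aff g ` Q)) ` carrier AGL" (is "?L = ?R")
  proof (intro subset_antisym subsetI)
    fix x assume "x \<in> ?L"
    then obtain P1 P2 where x: "x = body_dist P1 P2" and bodies: "P1 \<in> bodies" "P2 \<in> bodies"
      and "body_class P1 = body_class P" "body_class P2 = body_class Q"
      by blast
    then obtain g h where g: "g \<in> carrier AGL" "P1 = aff g ` P" and h: "h \<in> carrier AGL" "P2 = aff h ` Q"
      using P Q by (auto simp: body_class_eq_iff)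
    let ?k = "inv\<^bsub>AGL\<^esub> g \<otimes>\<^bsub>AGL\<^esub> h"
    have "g \<otimes>\<^bsub>AGL\<^esub> ?k = h"
      using g(1) h(1) by (metis inv_closed inv_solve_left' m_closed)
    then have "P2 = aff g ` aff ?k ` Q"
      using h(2) by (simp add: image_image flip: aff_mult)
    then have "x = body_dist (aff g ` P) (aff g ` aff ?k ` Q)"
      by (simp add: x g(2))
    also have "\<dots> = body_dist P (aff ?k ` Q)"
      using g(1) h(1) P Q by (intro body_dist_aff_image aff_image_bodies) simp_all
    finally show "x \<in> ?R"
      using g(1) h(1) by blast
  next
    fix x assume "x \<in> ?R"
    then obtain g where g: "g \<in> carrier AGL" and x: "x = body_dist P (aff g ` Q)"
      by blast
    have "body_class (aff g ` Q) = body_class Q"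
      using body_class_eq_iff[OF aff_image_bodies[OF g Q] Q] g by blast
    then show "x \<in> ?L"
      using P aff_image_bodies[OF g Q] x by blast
  qed
  then show ?thesis
    using P Q by (simp add: moduli_dist_def moduli_eq)
qed

lemma body_dist_nonneg: "body_dist P Q \<ge> 0"
  by (simp add: body_dist_def)

text \<open>A strict bound on an infimum is witnessed by some element even if the infimum is not
  attained. Later arguments use the orbit distance in this form.\<close>

lemma moduli_dist_less_iff:
  fixes P Q :: "(real ^ 'n) set"
  assumes "P \<in> bodies" "Q \<in> bodies"
  shows "moduli_dist (body_class P) (body_class Q) < r \<longleftrightarrow> (\<exists>g\<in>carrier AGL. body_dist P (aff g ` Q) < r)"
proof -
  interpret group "AGL :: ((int ^ 'n ^ 'n) \<times> (real ^ 'n)) monoid" by (rule group_AGL)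
  have "bdd_below ((\<lambda>g. body_dist P (aff g ` Q)) ` carrier AGL)"
    by (auto intro: bdd_belowI2[of _ 0] body_dist_nonneg)
  moreover have "carrier AGL \<noteq> ({} :: ((int ^ 'n ^ 'n) \<times> (real ^ 'n)) set)"
    using one_closed by blast
  ultimately show ?thesis
    using assms by (simp add: moduli_dist_body_class cINF_less_iff)
qed

section \<open>Bounds on the transformations that bring \<open>Q\<close> close to
  \<open>P\<close>\<close>

text \<open>If \<open>A e\<close> is longer than the diameter of \<open>P\<close> for some short \<open>e\<close>, then the image of a small ball
  and its translate by \<open>A e\<close> both lie in the image of \<open>Q\<close>, but \<open>P\<close> cannot meet both at
  corresponding points; hence at least half of the volume of the small ball lies outside \<open>P\<close>.\<close>

lemma close_images_bounded:
  fixes P Q :: "(real ^ 'n) set"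
  assumes P: "P \<in> bodies" and Q: "Q \<in> bodies" and "Q \<noteq> {}"
  obtains c K where "c > 0"
    "\<And>A t. (A, t) \<in> carrier AGL \<Longrightarrow> body_dist P (aff (A, t) ` Q) < c \<Longrightarrow>
      (\<forall>x. norm (map_matrix real_of_int A *v x) \<le> K * norm x) \<and> norm t \<le> K"
proof -
  \<comment> \<open>The doubled radius leaves room to shift the ball of radius \<open>r\<close> by
    any vector of norm at most \<open>r\<close> without leaving \<open>Q\<close>.\<close>
  obtain q r where r: "r > 0" and ball: "ball q (2 * r) \<subseteq> Q"
  proof -
    have "\<exists>q e. e > 0 \<and> ball q e \<subseteq> Q"
      using bodies_subsetI[OF Q, of "{}"] \<open>Q \<noteq> {}\<close> by blast
    then obtain q e where "e > 0" "ball q e \<subseteq> Q"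
      by blast
    then show thesis
      by (intro that[of "e / 2" q]) auto
  qed
  obtain R where R: "\<And>x. x \<in> P \<Longrightarrow> norm x \<le> R" and "R > 0"
    using bounded_bodies[OF P] by (auto simp: bounded_pos)
  \<comment> \<open>Half of the volume of the small ball. The group preserves this volume, so if
    less than \<open>c\<close> of the image ball lies outside \<open>P\<close>, more than
    \<open>c\<close> lies inside.\<close>
  define c where "c = measure lebesgue (ball q r) / 2"
  \<comment> \<open>Vectors of norm at most \<open>r\<close> will be sent to vectors of norm at most
    \<open>2 * R\<close>; by scaling this is an operator norm bound
    \<open>2 * R / r\<close>.\<close>
  define K where "K = 2 * R / r"
  show thesis
  proof
    show "c > 0"
      using measure_ball_pos[OF r] by (simp add: c_def)
    fix A t
    assume g: "(A, t) \<in> carrier AGL" and close: "body_dist P (aff (A, t) ` Q) < c"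
    let ?A = "map_matrix real_of_int A"
    let ?E = "aff (A, t) ` ball q r"
    have gQ: "aff (A, t) ` Q \<in> bodies"
      using g Q by (rule aff_image_bodies)
    have lt: "measure lebesgue (aff (A, t) ` Q - P) < c"
      using measure_Diff_le_body_dist(2)[OF P gQ] close by simp
    have E: "measure lebesgue ?E = 2 * c"
      using g by (simp add: measure_aff_image c_def)
    have "open ?E"
      using homeomorphism_imp_open_map[OF homeomorphism_aff[OF g]] by simp
    moreover have EQ: "?E \<subseteq> aff (A, t) ` Q"
      using ball r by (auto simp: subset_iff)
    ultimately have Em: "?E \<in> lmeasurable"
      using bounded_bodies[OF gQ] by (meson bounded_subset lmeasurable_open)
    note meas = bodies_lmeasurable[OF P] bodies_lmeasurable[OF gQ] Em
    have diff: "measure lebesgue (?E - P) < c"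
    proof -
      have "measure lebesgue (?E - P) \<le> measure lebesgue (aff (A, t) ` Q - P)"
        using EQ by (intro measure_mono_fmeasurable) (auto simp: meas fmeasurable.Diff fmeasurableD)
      then show ?thesis using lt by simp
    qed
    have int: "measure lebesgue (?E \<inter> P) > c"
    proof -
      have "measure lebesgue (?E - ?E \<inter> P) = measure lebesgue ?E - measure lebesgue (?E \<inter> P)"
        by (rule measurable_measure_Diff) (simp_all add: meas fmeasurable.Int fmeasurableD)
      moreover have "?E - ?E \<inter> P = ?E - P"
        by blast
      ultimately show ?thesis
        using diff E by simp
    qed
    have short: "norm (?A *v e) \<le> 2 * R" if e: "norm e \<le> r" for e
    proof (rule ccontr)
      assume long: "\<not> norm (?A *v e) \<le> 2 * R"
      \<comment> \<open>Two points of \<open>P\<close> differ by at most \<open>2 * R\<close> in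
        norm, so the long shift moves \<open>?E \<inter> P\<close> off \<open>P\<close>, yet it
        stays in the image of \<open>Q\<close>. A set of volume more than \<open>c\<close> would
        then fit into one of volume less than \<open>c\<close>.\<close>
      have "(+) (?A *v e) ` (?E \<inter> P) \<subseteq> aff (A, t) ` Q - P"
      proof
        fix y assume "y \<in> (+) (?A *v e) ` (?E \<inter> P)"
        then obtain x where x: "x \<in> ball q r" "aff (A, t) x \<in> P" and y: "y = ?A *v e + aff (A, t) x"
          by blast
        have "dist q (x + e) \<le> dist q x + norm e"
          using dist_triangle[of q "x + e" x] by (simp add: dist_norm)
        then have "x + e \<in> Q"
          using x(1) e ball by (auto simp: subset_iff)
        moreover have "y = aff (A, t) (x + e)"
          by (simp add: y aff_def matrix_vector_right_distrib)
        moreover have "y \<notin> P"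
        proof
          assume "y \<in> P"
          then have "norm (y - aff (A, t) x) \<le> R + R"
            using norm_triangle_ineq4[of y "aff (A, t) x"] R[of y] R[OF x(2)] by linarith
          then show False
            using long by (simp add: y)
        qed
        ultimately show "y \<in> aff (A, t) ` Q - P"
          by blast
      qed
      then have "measure lebesgue ((+) (?A *v e) ` (?E \<inter> P)) \<le> measure lebesgue (aff (A, t) ` Q - P)"
        by (intro measure_mono_fmeasurable)
          (auto simp: meas fmeasurable.Diff fmeasurable.Int intro!: fmeasurableD measurable_translation)
      then show False
        using lt int by (simp add: measure_translation)
    qed
    have bound: "norm (?A *v x) \<le> K * norm x" for x
    proof (cases "x = 0")
      case False
      have "norm (?A *v ((r / norm x) *\<^sub>R x)) \<le> 2 * R"
        using r by (intro short) simp
      then show ?thesis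
        using r False by (simp add: K_def matrix_vector_mult_scaleR field_simps)
    qed simp
    have "K \<ge> 0"
      using \<open>R > 0\<close> r by (simp add: K_def)
    \<comment> \<open>A point \<open>x\<close> of the ball whose image lies in \<open>P\<close>
      controls the translation, since \<open>t\<close> is that bounded image minus the bounded
      vector \<open>?A *v x\<close>.\<close>
    have "?E \<inter> P \<noteq> {}"
      using int \<open>c > 0\<close> by auto
    then obtain x where x: "x \<in> ball q r" "aff (A, t) x \<in> P"
      by blast
    have "norm x \<le> norm q + r"
      using x(1) norm_triangle_sub[of x q] by (simp add: dist_norm norm_minus_commute)
    then have "norm (?A *v x) \<le> K * (norm q + r)"
      using bound[of x] \<open>K \<ge> 0\<close> by (meson mult_left_mono order_trans)
    moreover have "norm t \<le> norm (aff (A, t) x) + norm (?A *v x)"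
      using norm_triangle_ineq4[of "aff (A, t) x" "?A *v x"] by (simp add: aff_def)
    ultimately have "norm t \<le> R + K * (norm q + r)"
      using R[OF x(2)] by simp
    \<comment> \<open>The sum of all bounds serves as a single constant for both the linear part and
      the translation.\<close>
    moreover have "K * norm x \<le> (K + R + K * (norm q + r)) * norm x" for x
      using \<open>K \<ge> 0\<close> \<open>R > 0\<close> r by (intro mult_right_mono) simp_all
    ultimately show "(\<forall>x. norm (?A *v x) \<le> (K + R + K * (norm q + r)) * norm x) \<and>
        norm t \<le> K + R + K * (norm q + r)"
      using order_trans[OF bound] \<open>K \<ge> 0\<close> by simp blast
  qed
qed

text \<open>The columns are the images of the unit vectors, so every entry is an integer of absolute
  value at most \<open>K\<close>, which leaves finitely many choices.\<close>

lemma finite_bounded_int_matrices: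
  fixes K :: real
  shows "finite {A :: int ^ 'n ^ 'm. \<forall>x. norm (map_matrix real_of_int A *v x) \<le> K * norm x}"
proof (rule finite_subset)
  let ?S = "{- \<lceil>K\<rceil>..\<lceil>K\<rceil>}"
  let ?F = "(\<lambda>f. \<chi> i j. f (i, j)) ` (UNIV \<rightarrow>\<^sub>E ?S)"
  show "finite ?F"
    by (intro finite_imageI finite_PiE) auto
  show "{A :: int ^ 'n ^ 'm. \<forall>x. norm (map_matrix real_of_int A *v x) \<le> K * norm x} \<subseteq> ?F"
  proof
    fix A :: "int ^ 'n ^ 'm"
    assume "A \<in> {A. \<forall>x. norm (map_matrix real_of_int A *v x) \<le> K * norm x}"
    then have "\<forall>x. norm (map_matrix real_of_int A *v x) \<le> K * norm x"
      by blast
    from this[THEN spec, of "axis _ 1"]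
    have le: "norm (map_matrix real_of_int A *v axis j 1) \<le> K" for j
      by simp
    have "\<bar>real_of_int (A $ i $ j)\<bar> \<le> K" for i j
      using component_le_norm_cart[of "map_matrix real_of_int A *v axis j 1" i] le[of j]
      by (simp add: matrix_vector_mult_basis column_def)
    then have "real_of_int \<bar>A $ i $ j\<bar> \<le> real_of_int \<lceil>K\<rceil>" for i j
      using le_of_int_ceiling[of K] by (metis of_int_abs order_trans)
    then have "A $ i $ j \<in> ?S" for i j
      unfolding of_int_le_iff by (simp add: abs_le_iff minus_le_iff)
    then show "A \<in> ?F"
      by (intro image_eqI[of _ _ "\<lambda>(i, j). A $ i $ j"]) (auto simp: vec_eq_iff)
  qed
qed

section \<open>Limits of images and definiteness of the orbit distance\<close>

text \<open>A ball in \<open>P\<close> missing the limit translate has a concentric ball of half the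
  radius that misses all translates with \<open>t k\<close> within \<open>e / 2\<close> of
  \<open>s\<close>. Its fixed positive volume would bound the differences from below.\<close>

lemma bodies_subset_limit_translate:
  assumes P: "P \<in> bodies" and B: "B \<in> bodies" and t: "t \<longlonglongrightarrow> s"
    and lim: "(\<lambda>k. measure lebesgue (P - (+) (t k) ` B)) \<longlonglongrightarrow> 0"
  shows "P \<subseteq> (+) s ` B"
proof (rule bodies_subsetI[OF P])
  show "closed ((+) s ` B)"
    using B by (intro closed_translation bodies_closed)
  fix x e assume e: "e > 0" "ball x e \<subseteq> P" "ball x e \<inter> (+) s ` B = {}"
  have "\<forall>\<^sub>F k in sequentially. dist (t k) s < e / 2"
    using t e(1) by (intro tendstoD) auto
  then have "\<forall>\<^sub>F k in sequentially. measure lebesgue (ball x (e / 2)) \<le> measure lebesgue (P - (+) (t k) ` B)"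
  proof (rule eventually_mono)
    fix k assume k: "dist (t k) s < e / 2"
    have "ball x (e / 2) \<inter> (+) (t k) ` B = {}"
    proof (rule ccontr)
      assume "ball x (e / 2) \<inter> (+) (t k) ` B \<noteq> {}"
      then obtain b where b: "b \<in> B" "dist x (t k + b) < e / 2"
        by auto
      have "dist x (s + b) \<le> dist x (t k + b) + dist (t k) s"
        using dist_triangle[of x "s + b" "t k + b"] by (simp add: dist_norm)
      then have "s + b \<in> ball x e"
        using b k by simp
      then show False
        using e(3) b(1) by blast
    qed
    then have "ball x (e / 2) \<subseteq> P - (+) (t k) ` B"
      using e by (auto simp: subset_iff)
    then show "measure lebesgue (ball x (e / 2)) \<le> measure lebesgue (P - (+) (t k) ` B)"
      using P B by (intro measure_mono_fmeasurable)
        (auto simp: bodies_lmeasurable fmeasurable.Diff fmeasurableD measurable_translation)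
  qed
  then have "measure lebesgue (ball x (e / 2)) \<le> 0"
    using lim by (intro tendsto_lowerbound) auto
  then show False
    using measure_ball_pos[of "e / 2" x] e(1) by linarith
qed

lemma bodies_translate: "B \<in> bodies \<Longrightarrow> (+) t ` B \<in> bodies"
  using aff_image_bodies[of "(mat 1, t)" B]
  by (simp add: AGL_def aff_def map_matrix_of_int_mat1 invertible_def add.commute[of _ t])

text \<open>The one-sided lemma is used twice, the second time with the roles of the bodies
  exchanged and the translations negated.\<close>

lemma bodies_eq_limit_translate:
  assumes P: "P \<in> bodies" and B: "B \<in> bodies" and t: "t \<longlonglongrightarrow> s"
    and lim: "(\<lambda>k. body_dist P ((+) (t k) ` B)) \<longlonglongrightarrow> 0"
  shows "P = (+) s ` B"
proof
  show "P \<subseteq> (+) s ` B"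
    using P B t
  proof (rule bodies_subset_limit_translate)
    show "(\<lambda>k. measure lebesgue (P - (+) (t k) ` B)) \<longlonglongrightarrow> 0"
      by (rule tendsto_sandwich[OF _ _ tendsto_const lim])
        (auto simp: measure_Diff_le_body_dist P B bodies_translate)
  qed
  have "B \<subseteq> (+) (- s) ` P"
    using B P tendsto_minus[OF t]
  proof (rule bodies_subset_limit_translate)
    \<comment> \<open>Translating by \<open>t k\<close> converts the difference of \<open>B\<close>
      and the shifted \<open>P\<close> into the difference of the shifted \<open>B\<close> and
      \<open>P\<close>, which \<open>lim\<close> controls.\<close>
    have "(+) (t k) ` (B - (+) (- t k) ` P) = (+) (t k) ` B - P" for k
      by (simp add: image_set_diff image_image)
    then have "measure lebesgue (B - (+) (- t k) ` P) = measure lebesgue ((+) (t k) ` B - P)" for k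
      by (metis measure_translation)
    then show "(\<lambda>k. measure lebesgue (B - (+) (- t k) ` P)) \<longlonglongrightarrow> 0"
      by (intro tendsto_sandwich[OF _ _ tendsto_const lim])
        (auto simp: measure_Diff_le_body_dist P B bodies_translate)
  qed
  then show "(+) s ` B \<subseteq> P"
    using image_mono[of B "(+) (- s) ` P" "(+) s"] by (simp add: image_image)
qed

text \<open>Orbit distance zero gives only approximations; compactness of the admissible
  transformations turns them into an exact equality.\<close>

lemma body_eq_image_if_arbitrarily_close:
  fixes P Q :: "(real ^ 'n) set"
  assumes P: "P \<in> bodies" and Q: "Q \<in> bodies"
    and close: "\<And>\<epsilon>. \<epsilon> > 0 \<Longrightarrow> \<exists>g\<in>carrier AGL. body_dist P (aff g ` Q) < \<epsilon>"
  shows "\<exists>g\<in>carrier AGL. P = aff g ` Q"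
proof (cases "Q = {}")
  case True
  \<comment> \<open>All images of the empty body are empty, so the distance does not depend on
    \<open>g\<close>. This case is separate because the bounds on \<open>g\<close> come from a ball
    in \<open>Q\<close>.\<close>
  have "body_dist P {} < \<epsilon>" if "\<epsilon> > 0" for \<epsilon>
    using close[OF that] True by auto
  then have "body_dist P {} = 0"
    using body_dist_nonneg[of P "{}"] by (meson less_irrefl linorder_neqE_linordered_idom not_less)
  then have "P = {}"
    using P Q True body_dist_eq_0D by blast
  then show ?thesis
    using True close[of 1] by auto
next
  case False
  obtain c K where "c > 0" and bound:
    "\<And>A t. (A, t) \<in> carrier AGL \<Longrightarrow> body_dist P (aff (A, t) ` Q) < c \<Longrightarrow>
      (\<forall>x. norm (map_matrix real_of_int A *v x) \<le> K * norm x) \<and> norm t \<le> K"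
    using close_images_bounded[OF P Q False] by metis
  \<comment> \<open>Staying below \<open>c\<close> makes the bounds available for every term; the
    reciprocal forces convergence to 0.\<close>
  have "\<exists>A t. (A, t) \<in> carrier AGL \<and> body_dist P (aff (A, t) ` Q) < min c (inverse (real (Suc k)))" for k
    using close[of "min c (inverse (real (Suc k)))"] \<open>c > 0\<close> by auto
  then obtain A t where g: "\<And>k. (A k, t k) \<in> carrier AGL"
    and lt: "\<And>k. body_dist P (aff (A k, t k) ` Q) < min c (inverse (real (Suc k)))"
    by metis
  have lim: "(\<lambda>k. body_dist P (aff (A k, t k) ` Q)) \<longlonglongrightarrow> 0"
  proof (rule tendsto_sandwich[OF _ _ tendsto_const LIMSEQ_inverse_real_of_nat])
    show "\<forall>\<^sub>F k in sequentially. body_dist P (aff (A k, t k) ` Q) \<le> inverse (real (Suc k))"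
      using lt by (intro always_eventually) (simp add: less_imp_le)
  qed (simp add: body_dist_nonneg)
  have "A ` UNIV \<subseteq> {A. \<forall>x. norm (map_matrix real_of_int A *v x) \<le> K * norm x}"
    using bound g lt by (intro image_subsetI CollectI) (metis min_less_iff_conj)
  then have "finite (A ` UNIV)"
    by (rule finite_subset) (rule finite_bounded_int_matrices)
  \<comment> \<open>Finitely many linear parts occur, so one occurs infinitely often; along these
    indices only the translation varies, and a further subsequence makes it converge.\<close>
  then obtain k0 where "infinite {k \<in> UNIV. A k = A k0}"
    using pigeonhole_infinite[of UNIV A] by auto
  then obtain r :: "nat \<Rightarrow> nat" where r: "strict_mono r" and A: "\<And>k. A (r k) = A k0"
    using infinite_enumerate[of "{k \<in> UNIV. A k = A k0}"] by auto
  have "\<forall>k. (t \<circ> r) k \<in> cball 0 K"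
    using bound[OF g] lt by (metis comp_apply mem_cball_0 min_less_iff_conj)
  then obtain s r' where r': "strict_mono (r' :: nat \<Rightarrow> nat)" and "((t \<circ> r) \<circ> r') \<longlonglongrightarrow> s"
    using compact_cball[of "0 :: real ^ 'n" K] unfolding compact_def by blast
  then have s: "(\<lambda>k. t (r (r' k))) \<longlonglongrightarrow> s"
    by (simp add: comp_def)
  \<comment> \<open>With the linear part frozen, the images of \<open>Q\<close> are translates of
    this fixed body.\<close>
  let ?B = "aff (A k0, 0) ` Q"
  have eq: "(+) u ` ?B = aff (A k0, u) ` Q" for u
    by (simp add: image_image aff_def add.commute)
  have carrier: "(A k0, u) \<in> carrier AGL" for u
    using g[of k0] by (simp add: AGL_def)
  have "P = (+) s ` ?B"
  proof (rule bodies_eq_limit_translate[OF P _ s])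
    show "?B \<in> bodies"
      using carrier Q by (rule aff_image_bodies)
    show "(\<lambda>k. body_dist P ((+) (t (r (r' k))) ` ?B)) \<longlonglongrightarrow> 0"
      using LIMSEQ_subseq_LIMSEQ[OF lim strict_mono_o[OF r r']]
      by (simp add: eq A comp_def)
  qed
  then show ?thesis
    using carrier eq by auto
qed

section \<open>The metric and the two topologies on the moduli space\<close>

lemma Metric_space_moduli:
  "Metric_space (moduli :: (real ^ 'n) set set set) moduli_dist"
proof -
  interpret group "AGL :: ((int ^ 'n ^ 'n) \<times> (real ^ 'n)) monoid" by (rule group_AGL)
  have nonneg: "0 \<le> moduli_dist \<alpha> \<beta>" for \<alpha> \<beta> :: "(real ^ 'n) set set"
  \<comment> \<open>Outside \<open>moduli\<close> the default value 0 settles the claim; inside,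
    every term of the nonempty infimum is nonnegative.\<close>
  proof (cases "\<alpha> \<in> moduli \<and> \<beta> \<in> moduli")
    case True
    then show ?thesis
      by (auto simp: moduli_eq moduli_dist_body_class body_dist_nonneg ex_in_conv[symmetric]
          intro!: cINF_greatest one_closed)
  qed (auto simp: moduli_dist_def)
  have commute: "moduli_dist \<alpha> \<beta> = moduli_dist \<beta> \<alpha>" for \<alpha> \<beta> :: "(real ^ 'n) set set"
  proof -
    have "{body_dist P1 P2 | P1 P2. P1 \<in> bodies \<and> P2 \<in> bodies \<and> body_class P1 = \<alpha> \<and> body_class P2 = \<beta>} =
      {body_dist P1 P2 | P1 P2. P1 \<in> bodies \<and> P2 \<in> bodies \<and> body_class P1 = \<beta> \<and> body_class P2 = \<alpha>}"
      using body_dist_commute by blast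
    then show ?thesis
      by (simp add: moduli_dist_def)
  qed
  \<comment> \<open>The triangle inequality in strict form, so that near-optimal \<open>g\<close>
    and \<open>h\<close> suffice; invariance under \<open>g\<close> aligns the second approximation
    with the first.\<close>
  have less_add: "moduli_dist \<alpha> \<gamma> < r + s"
    if mem: "\<alpha> \<in> moduli" "\<beta> \<in> moduli" "\<gamma> \<in> moduli" and less: "moduli_dist \<alpha> \<beta> < r" "moduli_dist \<beta> \<gamma> < s"
    for \<alpha> \<beta> \<gamma> :: "(real ^ 'n) set set" and r s
  proof -
    obtain P Q R where bodies: "P \<in> bodies" "Q \<in> bodies" "R \<in> bodies"
      and eq: "\<alpha> = body_class P" "\<beta> = body_class Q" "\<gamma> = body_class R"
      using mem by (auto simp: moduli_eq)
    obtain g h where g: "g \<in> carrier AGL" "body_dist P (aff g ` Q) < r"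
      and h: "h \<in> carrier AGL" "body_dist Q (aff h ` R) < s"
      using less bodies by (auto simp: eq moduli_dist_less_iff)
    have "body_dist P (aff g ` aff h ` R) \<le> body_dist P (aff g ` Q) + body_dist (aff g ` Q) (aff g ` aff h ` R)"
      using bodies g(1) h(1) by (intro body_dist_triangle aff_image_bodies)
    also have "body_dist (aff g ` Q) (aff g ` aff h ` R) = body_dist Q (aff h ` R)"
      using bodies g(1) h(1) by (intro body_dist_aff_image aff_image_bodies)
    also have "aff g ` aff h ` R = aff (g \<otimes>\<^bsub>AGL\<^esub> h) ` R"
      by (simp add: image_image aff_mult)
    finally have "body_dist P (aff (g \<otimes>\<^bsub>AGL\<^esub> h) ` R) < r + s"
      using g(2) h(2) by linarith
    then show ?thesis
      using bodies g(1) h(1) by (auto simp: eq moduli_dist_less_iff)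
  qed
  show ?thesis
  proof
    fix \<alpha> \<beta> \<gamma> :: "(real ^ 'n) set set"
    assume mem: "\<alpha> \<in> moduli" "\<beta> \<in> moduli"
    then obtain P Q where bodies: "P \<in> bodies" "Q \<in> bodies"
      and eq: "\<alpha> = body_class P" "\<beta> = body_class Q"
      by (auto simp: moduli_eq)
    show "moduli_dist \<alpha> \<beta> = 0 \<longleftrightarrow> \<alpha> = \<beta>"
    proof
      assume "moduli_dist \<alpha> \<beta> = 0"
      then have "\<exists>g\<in>carrier AGL. body_dist P (aff g ` Q) < \<epsilon>" if "\<epsilon> > 0" for \<epsilon>
        using moduli_dist_less_iff[OF bodies] that by (simp add: eq)
      then show "\<alpha> = \<beta>"
        using body_eq_image_if_arbitrarily_close[OF bodies] body_class_eq_iff[OF bodies] eq by simp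
    next
      assume "\<alpha> = \<beta>"
      have "body_dist P (aff \<one>\<^bsub>AGL\<^esub> ` P) = 0"
        by (simp add: aff_one body_dist_def)
      then have "moduli_dist \<alpha> \<beta> < \<epsilon>" if "\<epsilon> > 0" for \<epsilon>
        using that bodies one_closed \<open>\<alpha> = \<beta>\<close> by (metis eq(1) moduli_dist_less_iff)
      then show "moduli_dist \<alpha> \<beta> = 0"
        using nonneg[of \<alpha> \<beta>] by (meson less_irrefl linorder_neqE_linordered_idom not_less)
    qed
    \<comment> \<open>An arbitrary slack \<open>e\<close>, split evenly between the two distances,
      reduces this to the strict form.\<close>
    show "moduli_dist \<alpha> \<gamma> \<le> moduli_dist \<alpha> \<beta> + moduli_dist \<beta> \<gamma>" if "\<gamma> \<in> moduli"
    proof (rule field_le_epsilon)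
      fix e :: real assume "e > 0"
      then show "moduli_dist \<alpha> \<gamma> \<le> moduli_dist \<alpha> \<beta> + moduli_dist \<beta> \<gamma> + e"
        using less_add[OF mem that, of "moduli_dist \<alpha> \<beta> + e / 2" "moduli_dist \<beta> \<gamma> + e / 2"] by simp
    qed
  qed (use nonneg commute in auto)
qed

lemma moduli_metric_topology_eq_quotient:
  "(moduli_metric_topology :: (real ^ 'n) set set topology) = moduli_quotient_topology"
proof -
  interpret B: Metric_space "bodies :: (real ^ 'n) set set" body_dist by (rule Metric_space_bodies)
  interpret M: Metric_space "moduli :: (real ^ 'n) set set set" moduli_dist by (rule Metric_space_moduli)
  \<comment> \<open>The radius is the same on both sides: a strict distance bound between orbits can
    be realised by moving only the second representative.\<close>
  have ball: "M.mball (body_class P) r = body_class ` B.mball P r"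
    if P: "P \<in> bodies" for P :: "(real ^ 'n) set" and r
  proof (intro subset_antisym subsetI)
    fix \<beta> assume "\<beta> \<in> M.mball (body_class P) r"
    then obtain Q where Q: "Q \<in> bodies" "\<beta> = body_class Q" and "moduli_dist (body_class P) \<beta> < r"
      unfolding M.in_mball unfolding moduli_eq by blast
    then obtain g where g: "g \<in> carrier AGL" "body_dist P (aff g ` Q) < r"
      using P by (auto simp: moduli_dist_less_iff)
    then have "aff g ` Q \<in> B.mball P r"
      using P Q by (simp add: aff_image_bodies)
    moreover have "\<beta> = body_class (aff g ` Q)"
      using g(1) Q body_class_eq_iff[OF aff_image_bodies[OF g(1) Q(1)] Q(1)] by blast
    ultimately show "\<beta> \<in> body_class ` B.mball P r"
      by blast
  next
    interpret group "AGL :: ((int ^ 'n ^ 'n) \<times> (real ^ 'n)) monoid" by (rule group_AGL)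
    fix \<beta> assume "\<beta> \<in> body_class ` B.mball P r"
    then obtain Q where Q: "Q \<in> bodies" "\<beta> = body_class Q" "body_dist P Q < r"
      by auto
    moreover have "aff \<one>\<^bsub>AGL\<^esub> ` Q = Q"
      by (simp add: aff_one)
    ultimately have "moduli_dist (body_class P) \<beta> < r"
      using P one_closed by (metis moduli_dist_less_iff)
    then show "\<beta> \<in> M.mball (body_class P) r"
      using P Q unfolding M.in_mball unfolding moduli_eq by blast
  qed
  have "openin M.mtopology U \<longleftrightarrow> openin moduli_quotient_topology U" for U :: "(real ^ 'n) set set set"
  proof -
    \<comment> \<open>An image lies in \<open>U\<close> exactly when the original set lies in the
      preimage of \<open>U\<close>, so the same radius witnesses openness in both
      topologies.\<close>
    have preimage: "M.mball (body_class P) r \<subseteq> U \<longleftrightarrow> B.mball P r \<subseteq> {P \<in> bodies. body_class P \<in> U}"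
      if "P \<in> bodies" for P r
      unfolding ball[OF that] image_subset_iff using B.mball_subset_mspace by blast
    \<comment> \<open>Every orbit has a representative, so quantification over orbits becomes
      quantification over bodies.\<close>
    have "openin M.mtopology U \<longleftrightarrow> U \<subseteq> moduli \<and>
        (\<forall>P\<in>bodies. body_class P \<in> U \<longrightarrow> (\<exists>r>0. M.mball (body_class P) r \<subseteq> U))"
      unfolding M.openin_mtopology unfolding moduli_eq by blast
    also have "\<dots> \<longleftrightarrow> U \<subseteq> moduli \<and>
        (\<forall>P\<in>bodies. body_class P \<in> U \<longrightarrow> (\<exists>r>0. B.mball P r \<subseteq> {P \<in> bodies. body_class P \<in> U}))"
      by (simp only: preimage cong: ball_cong)
    also have "\<dots> \<longleftrightarrow> openin moduli_quotient_topology U"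
      by (simp add: moduli_quotient_topology_def openin_quotient_topology body_topology_def
          B.openin_mtopology moduli_eq Ball_def imp_conjL)
    finally show ?thesis .
  qed
  then show ?thesis
    by (simp add: topology_eq moduli_metric_topology_def)
qed

theorem theorem3p3:
  shows "(moduli_metric_topology :: (real ^ 'n) set set topology)
            homeomorphic_space (moduli_quotient_topology :: (real ^ 'n) set set topology)
       \<and> Hausdorff_space (moduli_quotient_topology :: (real ^ 'n) set set topology)"
proof
  \<comment> \<open>The topologies are equal, so the identity is a homeomorphism and the Hausdorff
    property transfers from the metric topology.\<close>
  show "(moduli_metric_topology :: (real ^ 'n) set set topology) homeomorphic_space
      (moduli_quotient_topology :: (real ^ 'n) set set topology)"
    by (simp add: moduli_metric_topology_eq_quotient)
  show "Hausdorff_space (moduli_quotient_topology :: (real ^ 'n) set set topology)"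
    unfolding moduli_metric_topology_eq_quotient[symmetric] moduli_metric_topology_def
    by (rule Metric_space.Hausdorff_space_mtopology[OF Metric_space_moduli])
qed

end
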